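(* Let $A\in\mathbb{C}_{n,n}$ with $\mathrm{Ind}(A)=k$, let $A=A_1+A_2$ be the core-EP decomposition of $A$, and suppose $$\mathrm{rk}(A^{k})=\mathrm{rk}\big((A^{k})^{\sim}A^{k}\big)=\mathrm{rk}(A_1A_1^{\sim})=r.$$ Then $$A^{(\mathrm{E})}=A_1^{\sharp}A_1A_1^{\mathfrak{m}},$$ where $A_1^{\sharp}$ is the group inverse of $A_1$ and $A_1^{\mathfrak{m}}$ is the Minkowski inverse of $A_1$.
   Context: $\mathbb{C}_{n,n}$ is the set of $n\times n$ complex matrices; $A^*$, $\mathrm{rk}(A)$, $\mathcal{R}(A)$ denote conjugate transpose, rank and column space. $\mathrm{Ind}(A)$ is the smallest positive integer $k$ with $\mathrm{rk}(A^{k+1})=\mathrm{rk}(A^k)$. The Minkowski metric matrix is $G=\begin{bmatrix}1&0\\ 0&-I_{n-1}\end{bmatrix}$ and the Minkowski adjoint of $A$ is $A^{\sim}=GA^*G$. Core-EP decomposition (known): every $A\in\mathbb{C}_{n,n}$ with $\mathrm{Ind}(A)=k$, $\mathrm{rk}(A^k)=r$ can be written uniquely as $A=A_1+A_2$ with $\mathrm{rk}(A_1^2)=\mathrm{rk}(A_1)$, $A_2^k=0$, $A_1^*A_2=A_2A_1=0$; moreover there is a unitary $U$ with $A_1=U\begin{bmatrix}T&S\\ 0&0\end{bmatrix}U^*$ and $A_2=U\begin{bmatrix}0&0\\ 0&N\end{bmatrix}U^*$, where $T\in\mathbb{C}_{r,r}$ is invertible and $N^k=0$. For $A$ with $\mathrm{Ind}(A)=k$,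 the $\mathfrak{m}$-core-EP inverse $A^{(\mathrm{E})}$ of $A$ is the matrix $X\in\mathbb{C}_{n,n}$ (unique if it exists) satisfying $XAX=X$, $XA^{k+1}=A^k$, $(AX)^{\sim}=AX$ and $\mathcal{R}(X)\subseteq\mathcal{R}(A^k)$. The Minkowski inverse $B^{\mathfrak{m}}$ of $B\in\mathbb{C}_{n,n}$ is the matrix $X$ (unique if it exists) with $BXB=B$, $XBX=X$, $(BX)^{\sim}=BX$, $(XB)^{\sim}=XB$; it exists if and only if $\mathrm{rk}(B^{\sim}B)=\mathrm{rk}(BB^{\sim})=\mathrm{rk}(B)$. The group inverse $B^{\sharp}$ of a matrix $B$ with $\mathrm{rk}(B^2)=\mathrm{rk}(B)$ is the unique $X$ with $BXB=B$, $XBX=X$, $BX=XB$. *)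

theory Defs
  imports
    "Jordan_Normal_Form.DL_Rank"
    "Jordan_Normal_Form.Schur_Decomposition"
begin

abbreviation cmat_rank :: "complex mat \<Rightarrow> nat" where
  "cmat_rank A \<equiv> vec_space.rank (dim_row A) A"

abbreviation cmat_range :: "complex mat \<Rightarrow> complex vec set" where
  "cmat_range A \<equiv> vec_space.col_space (dim_row A) A"

text \<open>The index is a positive integer by convention, so an invertible matrix has index 1.\<close>

definition mat_index :: "complex mat \<Rightarrow> nat" where
  "mat_index A = (LEAST k. 0 < k \<and> cmat_rank (A ^\<^sub>m (k + 1)) = cmat_rank (A ^\<^sub>m k))"

definition minkowski_metric :: "nat \<Rightarrow> complex mat" where
  "minkowski_metric n = mat_diag n (\<lambda>i. if i = 0 then 1 else - 1)"

definition minkowski_adjoint :: "complex mat \<Rightarrow> complex mat" where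
  "minkowski_adjoint A =
     minkowski_metric (dim_col A) * mat_adjoint A * minkowski_metric (dim_row A)"

text \<open>The three conditions below determine the pair \<open>(A1, A2)\<close> uniquely; the block form
  with respect to a unitary matrix is a consequence of them.\<close>

definition is_core_EP_decomposition ::
    "nat \<Rightarrow> complex mat \<Rightarrow> complex mat \<Rightarrow> complex mat \<Rightarrow> bool" where
  "is_core_EP_decomposition n A A1 A2 \<longleftrightarrow>
     A1 \<in> carrier_mat n n \<and> A2 \<in> carrier_mat n n \<and>
     A = A1 + A2 \<and>
     cmat_rank (A1 ^\<^sub>m 2) = cmat_rank A1 \<and>
     A2 ^\<^sub>m mat_index A = 0\<^sub>m n n \<and>
     mat_adjoint A1 * A2 = 0\<^sub>m n n \<and>
     A2 * A1 = 0\<^sub>m n n"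

definition is_m_core_EP_inverse :: "nat \<Rightarrow> complex mat \<Rightarrow> complex mat \<Rightarrow> bool" where
  "is_m_core_EP_inverse n A X \<longleftrightarrow>
     X \<in> carrier_mat n n \<and>
     X * A * X = X \<and>
     X * A ^\<^sub>m (mat_index A + 1) = A ^\<^sub>m mat_index A \<and>
     minkowski_adjoint (A * X) = A * X \<and>
     cmat_range X \<subseteq> cmat_range (A ^\<^sub>m mat_index A)"

definition is_minkowski_inverse :: "nat \<Rightarrow> complex mat \<Rightarrow> complex mat \<Rightarrow> bool" where
  "is_minkowski_inverse n B X \<longleftrightarrow>
     X \<in> carrier_mat n n \<and>
     B * X * B = B \<and>
     X * B * X = X \<and>
     minkowski_adjoint (B * X) = B * X \<and>
     minkowski_adjoint (X * B) = X * B"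

definition is_group_inverse :: "nat \<Rightarrow> complex mat \<Rightarrow> complex mat \<Rightarrow> bool" where
  "is_group_inverse n B X \<longleftrightarrow>
     X \<in> carrier_mat n n \<and>
     B * X * B = B \<and>
     X * B * X = X \<and>
     B * X = X * B"

text \<open>Each of the following operators is meaningful only for those square matrices that have
  such an inverse; for any other matrix its value is unspecified.\<close>

definition m_core_EP_inverse :: "complex mat \<Rightarrow> complex mat" where
  "m_core_EP_inverse A = (THE X. is_m_core_EP_inverse (dim_row A) A X)"

definition minkowski_inverse :: "complex mat \<Rightarrow> complex mat" where
  "minkowski_inverse B = (THE X. is_minkowski_inverse (dim_row B) B X)"

definition group_inverse :: "complex mat \<Rightarrow> complex mat" where
  "group_inverse B = (THE X. is_group_inverse (dim_row B) B X)"

end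

theory Submission
  imports Defs
begin

text \<open>
  Write \<open>B\<close> for the core part \<open>A\<^sub>1\<close> and \<open>B\<^sup>~\<close> for its Minkowski adjoint. Since \<open>A\<^sub>2 A\<^sub>1 = 0\<close>
  and \<open>A\<^sub>2\<close> is nilpotent, \<open>A\<^sup>k = B P\<close> and \<open>B = A\<^sup>k Q\<close> for suitable \<open>P\<close> and \<open>Q\<close>, so \<open>B\<close> and
  \<open>A\<^sup>k\<close> have the same column space. The rank hypotheses then say \<open>B = V B\<^sup>~ B\<close> and
  \<open>B = B B\<^sup>~ U\<close>, which produces the Minkowski inverse \<open>U\<^sup>~ B V\<^sup>~\<close>. As \<open>A B = B\<^sup>2\<close>, the
  matrix \<open>X = B\<^sup># B B\<^sup>m\<close> satisfies \<open>A X = B B\<^sup>m\<close>, from which the four defining equations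
  follow by algebra, without the unitary block form.
\<close>

section \<open>Column spaces and rank\<close>

context vec_space
begin

text \<open>Rank is the dimension of the column span as a space in its own right; the last two facts
  allow independence and span there to be read in the ambient space.\<close>

lemma span_cols_vs:
  assumes "A \<in> carrier_mat n nc"
  shows "vectorspace class_ring (span_vs (set (cols A)))"
    and "vectorspace.fin_dim class_ring (span_vs (set (cols A)))"
    and "\<And>T. T \<subseteq> col_space A \<Longrightarrow>
      LinearCombinations.module.lin_dep class_ring (span_vs (set (cols A))) T = lin_dep T"
    and "\<And>T. T \<subseteq> col_space A \<Longrightarrow>
      LinearCombinations.module.span class_ring (span_vs (set (cols A))) T = span T"
proof -
  have c: "set (cols A) \<subseteq> carrier_vec n" using cols_dim assms by blast
  show "vectorspace class_ring (span_vs (set (cols A)))"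
    using c span_is_subspace subspace_def subspace_is_vs by simp
  show "vectorspace.fin_dim class_ring (span_vs (set (cols A)))"
    using fin_dim_span_cols[OF assms] .
  show "LinearCombinations.module.lin_dep class_ring (span_vs (set (cols A))) T = lin_dep T"
    "LinearCombinations.module.span class_ring (span_vs (set (cols A))) T = span T"
    if "T \<subseteq> col_space A" for T
    using span_li_not_depend[of T "span (set (cols A))"] span_is_submodule[of "set (cols A)"]
      that c by (auto simp: col_space_def)
qed

lemma rank_witness:
  assumes "A \<in> carrier_mat n nc"
  obtains S where "S \<subseteq> set (cols A)" "lin_indpt S" "finite S" "card S = rank A"
proof -
  \<comment> \<open>The empty set is the independent set that gets enlarged to a maximal one among
    the columns.\<close>
  have "S \<subseteq> {} \<Longrightarrow> lin_indpt S" for S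
    by (simp add: lin_dep_def)
  then obtain S where S: "maximal S (\<lambda>T. T \<subseteq> set (cols A) \<and> lin_indpt T)"
    using maximal_exists_superset[of "set (cols A)" "\<lambda>T. T \<subseteq> set (cols A) \<and> lin_indpt T" "{}"]
    by auto
  show thesis
  proof (rule that)
    show "S \<subseteq> set (cols A)" "lin_indpt S" using S unfolding maximal_def by auto
    then show "finite S" using finite_subset by auto
    show "card S = rank A" using rank_card_indpt[OF assms S] ..
  qed
qed

lemma cols_subset_col_space:
  assumes "A \<in> carrier_mat n nc"
  shows "set (cols A) \<subseteq> col_space A"
  using in_own_span[of "set (cols A)"] cols_dim[of A] assms by (auto simp: col_space_def)

text \<open>Take \<open>rank A\<close> independent columns of \<open>A\<close>; they lie in the
  column space of \<open>B\<close>, whose dimension bounds their number.\<close>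

lemma rank_mono_col_space:
  assumes A: "A \<in> carrier_mat n a" and B: "B \<in> carrier_mat n b"
    and sub: "col_space A \<subseteq> col_space B"
  shows "rank A \<le> rank B"
proof -
  obtain S where S: "S \<subseteq> set (cols A)" "lin_indpt S" "finite S" "card S = rank A"
    using rank_witness[OF A] .
  have SB: "S \<subseteq> col_space B" using S(1) cols_subset_col_space[OF A] sub by blast
  show ?thesis
    using vectorspace.li_le_dim(2)[OF span_cols_vs(1,2)[OF B], of S] span_cols_vs(3)[OF B SB]
      SB S by (simp add: rank_def col_space_def)
qed

text \<open>The rank bound makes \<open>rank A\<close> independent columns of \<open>A\<close> a
  basis of the column space of \<open>B\<close>, while their span stays inside that of
  \<open>A\<close>.\<close>

lemma col_space_eqI:
  assumes A: "A \<in> carrier_mat n a" and B: "B \<in> carrier_mat n b"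
    and sub: "col_space A \<subseteq> col_space B" and rk: "rank B \<le> rank A"
  shows "col_space A = col_space B"
proof -
  obtain S where S: "S \<subseteq> set (cols A)" "lin_indpt S" "finite S" "card S = rank A"
    using rank_witness[OF A] .
  have SB: "S \<subseteq> col_space B" using S(1) cols_subset_col_space[OF A] sub by blast
  have "vectorspace.basis class_ring (span_vs (set (cols B))) S"
    using vectorspace.dim_li_is_basis[OF span_cols_vs(1,2)[OF B], of S]
      span_cols_vs(3)[OF B SB] SB S rk by (simp add: rank_def col_space_def)
  then have "span S = col_space B"
    using vectorspace.basis_def[OF span_cols_vs(1)[OF B]] span_cols_vs(4)[OF B SB]
    by (simp add: col_space_def)
  moreover have "span S \<subseteq> col_space A"
    using span_is_monotone[OF S(1)] by (simp add: col_space_def)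
  ultimately show ?thesis using sub by blast
qed

lemma col_space_mult_subset:
  assumes B: "B \<in> carrier_mat n b" and W: "W \<in> carrier_mat b c"
  shows "col_space (B * W) \<subseteq> col_space B"
proof -
  have "\<exists>y\<in>carrier_vec b. B *\<^sub>v y = B * W *\<^sub>v x" if "x \<in> carrier_vec c" for x
    using that B W by (intro bexI[of _ "W *\<^sub>v x"]) auto
  then show ?thesis
    using B W by (auto simp: col_space_eq[OF B] col_space_eq[OF mult_carrier_mat[OF B W]])
qed

text \<open>Converse of \<open>col_space_mult_subset\<close>: the columns of \<open>W\<close> are
  chosen preimages under \<open>B\<close> of the columns of \<open>A\<close>.\<close>

lemma col_space_subset_imp_factor:
  assumes A: "A \<in> carrier_mat n a" and B: "B \<in> carrier_mat n b"
    and sub: "col_space A \<subseteq> col_space B"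
  obtains W where "W \<in> carrier_mat b a" "A = B * W"
proof -
  have "\<exists>w. w \<in> carrier_vec b \<and> B *\<^sub>v w = col A j" if "j < a" for j
  proof -
    have "col A j \<in> set (cols A)" using that A by (auto simp: cols_def)
    then have "col A j \<in> col_space B" using cols_subset_col_space[OF A] sub by blast
    then show ?thesis using B by (auto simp: col_space_eq[OF B])
  qed
  then obtain w where w: "\<And>j. j < a \<Longrightarrow> w j \<in> carrier_vec b \<and> B *\<^sub>v w j = col A j"
    by metis
  let ?W = "mat_of_cols b (map w [0..<a])"
  show thesis
  proof (rule that)
    show W: "?W \<in> carrier_mat b a" by auto
    show "A = B * ?W"
    proof (rule mat_col_eqI)
      fix j assume "j < dim_col (B * ?W)"
      then have j: "j < a" by simp
      then have "col ?W j = w j" using w[OF j] by simp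
      then show "col A j = col (B * ?W) j"
        using col_mult2[OF B W j] w[OF j] by simp
    qed (use A B in auto)
  qed
qed

text \<open>\<open>F\<close> collects \<open>rank A\<close> independent columns of \<open>A\<close>,
  so it has the column space of \<open>A\<close>. This prepares the equality of row and column
  rank.\<close>

lemma full_rank_factorization:
  assumes A: "A \<in> carrier_mat n a"
  obtains F H where "F \<in> carrier_mat n (rank A)" "H \<in> carrier_mat (rank A) a" "A = F * H"
proof -
  obtain S where S: "S \<subseteq> set (cols A)" "lin_indpt S" "finite S" "card S = rank A"
    using rank_witness[OF A] .
  obtain fs where fs: "set fs = S" "distinct fs" using finite_distinct_list[OF S(3)] by blast
  have len: "length fs = rank A" using distinct_card[OF fs(2)] fs(1) S(4) by simp
  have dim: "set fs \<subseteq> carrier_vec n" using fs S(1) cols_dim[of A] A by auto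
  let ?F = "mat_of_cols n fs"
  have F: "?F \<in> carrier_mat n (rank A)" using len by auto
  have cF: "cols ?F = fs" using cols_mat_of_cols[OF dim] .
  have "rank ?F = rank A"
    using lin_indpt_full_rank[OF F] cF fs S by simp
  moreover have "col_space ?F \<subseteq> col_space A"
    unfolding col_space_def cF fs(1) by (rule span_is_monotone[OF S(1)])
  ultimately have "col_space ?F = col_space A"
    by (intro col_space_eqI[OF F A]) auto
  then show thesis
    using col_space_subset_imp_factor[OF A F] that[OF F] by auto
qed

end

section \<open>Row rank, and factorizations obtained from equal ranks\<close>

lemma rank_transpose_le:
  assumes A: "A \<in> carrier_mat n m"
  shows "vec_space.rank m A\<^sup>T \<le> vec_space.rank n A"
proof -
  obtain F H where F: "F \<in> carrier_mat n (vec_space.rank n A)"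
    and H: "H \<in> carrier_mat (vec_space.rank n A) m" and eq: "A = F * H"
    using vec_space.full_rank_factorization[OF A] .
  \<comment> \<open>The column space of the transpose lies in that of \<open>H\<^sup>T\<close>,
    which has only \<open>rank A\<close> columns.\<close>
  have T: "A\<^sup>T = H\<^sup>T * F\<^sup>T" using transpose_mult[OF F H] eq by simp
  have "vec_space.col_space m A\<^sup>T \<subseteq> vec_space.col_space m H\<^sup>T"
    unfolding T by (rule vec_space.col_space_mult_subset) (use F H in auto)
  then have "vec_space.rank m A\<^sup>T \<le> vec_space.rank m H\<^sup>T"
    by (rule vec_space.rank_mono_col_space[rotated 2]) (use A H in auto)
  also have "\<dots> \<le> vec_space.rank n A"
    by (rule vec_space.rank_le_nc) (use H in auto)
  finally show ?thesis .
qed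

lemma rank_transpose:
  assumes "A \<in> carrier_mat n m"
  shows "vec_space.rank m A\<^sup>T = vec_space.rank n A"
  using rank_transpose_le[OF assms] rank_transpose_le[of "A\<^sup>T" m n] assms by simp

text \<open>Equal ranks turn the inclusion of column spaces into an equality, so \<open>B\<close>
  factors back through \<open>B * C\<close>. In this form the rank hypotheses become algebraic
  identities.\<close>

lemma rank_mult_right_eq_imp_factor:
  assumes B: "B \<in> carrier_mat n b" and C: "C \<in> carrier_mat b c"
    and rk: "vec_space.rank n (B * C) = vec_space.rank n B"
  obtains W where "W \<in> carrier_mat c b" "B = B * C * W"
proof -
  have BC: "B * C \<in> carrier_mat n c" using B C by simp
  have "vec_space.col_space n (B * C) = vec_space.col_space n B"
    by (rule vec_space.col_space_eqI[OF BC B vec_space.col_space_mult_subset[OF B C]])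
      (simp add: rk)
  then show thesis
    using vec_space.col_space_subset_imp_factor[OF B BC] that by auto
qed

text \<open>The transposed version of the preceding lemma.\<close>

lemma rank_mult_left_eq_imp_factor:
  assumes C: "C \<in> carrier_mat m n" and B: "B \<in> carrier_mat n b"
    and rk: "vec_space.rank m (C * B) = vec_space.rank n B"
  obtains W where "W \<in> carrier_mat n m" "B = W * C * B"
proof -
  have "vec_space.rank b (B\<^sup>T * C\<^sup>T) = vec_space.rank b B\<^sup>T"
    using rank_transpose[OF mult_carrier_mat[OF C B]] rank_transpose[OF B] rk
      transpose_mult[OF C B] by simp
  then obtain W where W: "W \<in> carrier_mat m n" "B\<^sup>T = B\<^sup>T * C\<^sup>T * W"
    using rank_mult_right_eq_imp_factor[of "B\<^sup>T" b n "C\<^sup>T" m] B C by auto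
  have "B = (B\<^sup>T * C\<^sup>T * W)\<^sup>T" using W(2) by (metis transpose_transpose)
  also have "\<dots> = W\<^sup>T * (C * B)"
    using transpose_mult[of "B\<^sup>T * C\<^sup>T" b m W n] transpose_mult[of "B\<^sup>T" b n "C\<^sup>T" m] B C W(1) by simp
  also have "\<dots> = W\<^sup>T * C * B"
    using assoc_mult_mat[of "W\<^sup>T" n m C n B b] W B C by simp
  finally show thesis using that[of "W\<^sup>T"] W by simp
qed

section \<open>The Minkowski adjoint\<close>

lemma mat_adjoint_index:
  "i < dim_col A \<Longrightarrow> j < dim_row A \<Longrightarrow> mat_adjoint A $$ (i, j) = conjugate (A $$ (j, i))"
  by (simp add: mat_adjoint_def mat_of_rows_def)

lemma mat_adjoint_dim [simp]:
  "dim_row (mat_adjoint A) = dim_col A" "dim_col (mat_adjoint A) = dim_row A"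
  by (simp_all add: mat_adjoint_def)

lemma minkowski_metric_carrier [simp]: "minkowski_metric n \<in> carrier_mat n n"
  by (simp add: minkowski_metric_def)

lemma minkowski_adjoint_carrier [simp]:
  "A \<in> carrier_mat n m \<Longrightarrow> minkowski_adjoint A \<in> carrier_mat m n"
  unfolding minkowski_adjoint_def
  by (intro mult_carrier_mat[of _ m n] mult_carrier_mat[of _ m m]) auto

text \<open>The diagonal of the metric as a function of the index, used for entrywise
  computation.\<close>

definition minkowski_sign :: "nat \<Rightarrow> complex" where
  "minkowski_sign i = (if i = 0 then 1 else - 1)"

lemma minkowski_sign_simps [simp]:
  "minkowski_sign i * minkowski_sign i = 1"
  "minkowski_sign i * (minkowski_sign i * z) = z"
  "cnj (minkowski_sign i) = minkowski_sign i"
  by (simp_all add: minkowski_sign_def)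

text \<open>Diagonal factors only scale rows and columns, so the laws of the adjoint reduce to sign
  bookkeeping.\<close>

lemma minkowski_adjoint_eq:
  assumes A: "A \<in> carrier_mat n m"
  shows "minkowski_adjoint A =
    mat m n (\<lambda>(i, j). minkowski_sign i * cnj (A $$ (j, i)) * minkowski_sign j)"
proof -
  have ad: "mat_adjoint A \<in> carrier_mat m n" using A by auto
  show ?thesis
    using A unfolding minkowski_adjoint_def minkowski_metric_def minkowski_sign_def[symmetric]
    by (auto simp: mat_diag_mult_left[OF ad] mat_diag_mult_right[of _ m n] mat_adjoint_index
        intro!: eq_matI)
qed

lemma minkowski_adjoint_involution [simp]:
  assumes "A \<in> carrier_mat n m"
  shows "minkowski_adjoint (minkowski_adjoint A) = A"
  using assms minkowski_adjoint_carrier[OF assms]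
  by (intro eq_matI) (auto simp: minkowski_adjoint_eq[of _ m n] minkowski_adjoint_eq[of _ n m] mult_ac)

text \<open>The two metrics between the factors cancel: the sign of the summation index occurs twice
  in each summand.\<close>

lemma minkowski_adjoint_mult:
  assumes A: "A \<in> carrier_mat n m" and B: "B \<in> carrier_mat m l"
  shows "minkowski_adjoint (A * B) = minkowski_adjoint B * minkowski_adjoint A"
proof (rule eq_matI)
  fix i j
  assume "i < dim_row (minkowski_adjoint B * minkowski_adjoint A)"
    "j < dim_col (minkowski_adjoint B * minkowski_adjoint A)"
  then have "i < l" "j < n"
    using minkowski_adjoint_carrier[OF A] minkowski_adjoint_carrier[OF B] by auto
  then show "minkowski_adjoint (A * B) $$ (i, j) =
      (minkowski_adjoint B * minkowski_adjoint A) $$ (i, j)"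
    using A B
    by (auto simp: minkowski_adjoint_eq[OF A] minkowski_adjoint_eq[OF B]
        minkowski_adjoint_eq[OF mult_carrier_mat[OF A B]] scalar_prod_def
        sum_distrib_left sum_distrib_right mult_ac intro!: sum.cong)
qed (use minkowski_adjoint_carrier[OF A] minkowski_adjoint_carrier[OF B]
    minkowski_adjoint_carrier[OF mult_carrier_mat[OF A B]] in auto)

section \<open>Generalized inverses of square matrices\<close>

context
  fixes n :: nat
begin

private lemma closed [simp]:
  "X \<in> carrier_mat n n \<Longrightarrow> Y \<in> carrier_mat n n \<Longrightarrow> X * Y \<in> carrier_mat n n"
  by simp

private lemmas assoc = assoc_mult_mat[of _ n n _ n _ n]

private lemmas mink_mult = minkowski_adjoint_mult[of _ n n _ n]

text \<open>The adjoint reverses products. In the uniqueness proofs, two self-adjoint matrices of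
  which each product is one of the factors are thereby identified.\<close>

lemma minkowski_self_adjoint_commute:
  assumes "P \<in> carrier_mat n n" "Q \<in> carrier_mat n n"
    and "minkowski_adjoint P = P" "minkowski_adjoint Q = Q" "minkowski_adjoint (P * Q) = P * Q"
  shows "P * Q = Q * P"
  using mink_mult[of P Q] assms by simp

section \<open>The group and Minkowski inverses; uniqueness of the m-core-EP inverse\<close>

lemma group_inverse_ex:
  fixes B :: "complex mat"
  assumes B: "B \<in> carrier_mat n n" and Y: "Y \<in> carrier_mat n n" and Z: "Z \<in> carrier_mat n n"
    and BY: "B * B * Y = B" and ZB: "Z * B * B = B"
  shows "\<exists>X. is_group_inverse n B X"
proof -
  \<comment> \<open>Both sides are values of \<open>Z * B * B * Y\<close>, one for each
    factorization. Multiplying \<open>Z * B * Y\<close> by \<open>B\<close> on either side yields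
    this common matrix.\<close>
  have ZBBY: "Z * B = B * Y"
  proof -
    have "Z * B = Z * (B * B * Y)" using BY by simp
    also have "\<dots> = Z * B * B * Y" using B Y Z by (simp add: assoc)
    finally show ?thesis using ZB by simp
  qed
  have BYB: "B * Y * B = B" using ZB ZBBY by simp
  let ?X = "Z * B * Y"
  have X: "?X \<in> carrier_mat n n" using B Y Z by simp
  have BX: "B * ?X = B * Y"
  proof -
    have "B * ?X = B * (B * Y * Y)" using ZBBY by simp
    also have "\<dots> = B * B * Y * Y" using B Y by (simp add: assoc)
    finally show ?thesis using BY by simp
  qed
  have XB: "?X * B = B * Y"
  proof -
    have "?X * B = Z * (B * Y * B)" using B Y Z by (simp add: assoc)
    then show ?thesis using BYB ZBBY by simp
  qed
  have "?X * B * ?X = B * Y * (B * Y * Y)" using XB ZBBY by simp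
  also have "\<dots> = B * Y * B * Y * Y" using B Y by (simp add: assoc)
  also have "\<dots> = ?X" using BYB ZBBY by simp
  finally have "?X * B * ?X = ?X" .
  then show ?thesis
    using X BX XB BYB unfolding is_group_inverse_def by (intro exI[of _ ?X]) simp
qed

text \<open>Commutation identifies the idempotents \<open>X * B\<close> and \<open>B * Y\<close>;
  then \<open>X = X * B * X\<close> turns into \<open>Y * B * Y\<close>.\<close>

lemma group_inverse_unique:
  assumes B: "B \<in> carrier_mat n n" and gX: "is_group_inverse n B X" and gY: "is_group_inverse n B Y"
  shows "X = Y"
proof -
  have X: "X \<in> carrier_mat n n" "B * X * B = B" "X * B * X = X" "B * X = X * B"
    and Y: "Y \<in> carrier_mat n n" "B * Y * B = B" "Y * B * Y = Y" "B * Y = Y * B"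
    using gX gY unfolding is_group_inverse_def by auto
  have "X * B = X * (B * Y * B)" using Y by simp
  also have "\<dots> = X * B * (Y * B)" using B X(1) Y(1) by (simp add: assoc)
  also have "\<dots> = B * X * (B * Y)" using X Y by simp
  also have "\<dots> = B * X * B * Y" using B X(1) Y(1) by (simp add: assoc)
  finally have XB: "X * B = B * Y" using X by simp
  have "X = B * Y * X" using X XB by simp
  also have "\<dots> = Y * (B * X)" using Y B X(1) by (simp add: assoc)
  also have "\<dots> = Y * B * Y" using X(1,4) XB B Y(1) by (simp add: assoc)
  finally show ?thesis using Y by simp
qed

text \<open>As in a ring with involution: \<open>minkowski_adjoint V\<close> is a \<open>{1,3}\<close>-inverse,
  \<open>minkowski_adjoint Z\<close> is a \<open>{1,4}\<close>-inverse, and a \<open>{1,4}\<close>-inverse times \<open>B\<close> times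
  a \<open>{1,3}\<close>-inverse is the Minkowski inverse.\<close>

lemma minkowski_inverse_ex:
  assumes B: "B \<in> carrier_mat n n" and V: "V \<in> carrier_mat n n" and Z: "Z \<in> carrier_mat n n"
    and VB: "V * minkowski_adjoint B * B = B" and BZ: "B * minkowski_adjoint B * Z = B"
  shows "\<exists>X. is_minkowski_inverse n B X"
proof -
  let ?a = minkowski_adjoint
  have c [simp]: "?a B \<in> carrier_mat n n" "?a V \<in> carrier_mat n n" "?a Z \<in> carrier_mat n n"
    using B V Z by simp_all
  \<comment> \<open>With \<open>C = V * ?a B\<close> the left side is \<open>C * ?a C\<close>,
    self-adjoint by its form, and \<open>VB\<close> collapses it to \<open>?a C\<close>.\<close>
  have BVeq: "V * ?a B * (B * ?a V) = B * ?a V"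
    using B V assoc[of "V * ?a B" B "?a V", symmetric] VB by simp
  have BVsa: "?a (B * ?a V) = B * ?a V"
  proof -
    have "?a (B * ?a V) = V * ?a B" using B V by (simp add: mink_mult)
    moreover have "?a (V * ?a B * (B * ?a V)) = V * ?a B * (B * ?a V)"
      using B V by (simp add: mink_mult)
    ultimately show ?thesis using BVeq by simp
  qed
  then have BV: "B * ?a V = V * ?a B" using B V by (simp add: mink_mult)
  \<comment> \<open>The mirror argument: for \<open>D = ?a Z * B\<close>, the identity
    \<open>BZ\<close> collapses \<open>D * ?a D\<close> to \<open>D\<close>.\<close>
  have ZBeq: "?a Z * B * (?a B * Z) = ?a Z * B"
    using B Z BZ assoc[of B "?a B" Z] by (simp add: assoc)
  have ZBsa: "?a (?a Z * B) = ?a Z * B"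
  proof -
    have "?a (?a Z * B * (?a B * Z)) = ?a Z * B * (?a B * Z)"
      using B Z by (simp add: mink_mult)
    then show ?thesis using ZBeq by simp
  qed
  then have ZB: "?a Z * B = ?a B * Z" using B Z by (simp add: mink_mult)
  have BVB: "B * ?a V * B = B" using BV VB by simp
  have BZB: "B * (?a Z * B) = B" using ZB BZ B Z by (simp add: assoc)
  let ?X = "?a Z * B * ?a V"
  have BX: "B * ?X = B * ?a V"
    using BZB B V Z assoc[of B "?a Z * B" "?a V"] by simp
  have XB: "?X * B = ?a Z * B"
    using BVB B V Z by (simp add: assoc)
  have "?X * B * ?X = ?a Z * (B * ?X)"
    unfolding XB using B V Z by (simp add: assoc)
  also have "\<dots> = ?X" unfolding BX using B V Z by (simp add: assoc)
  finally have "?X * B * ?X = ?X" .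
  moreover have "?X \<in> carrier_mat n n" using B V Z by simp
  ultimately show ?thesis
    unfolding is_minkowski_inverse_def using BX XB BVsa ZBsa BVB
    by (intro exI[of _ ?X]) simp
qed

text \<open>The projections \<open>B * X\<close> and \<open>B * Y\<close> agree, as do
  \<open>X * B\<close> and \<open>Y * B\<close>, whence \<open>X = X * B * Y = Y\<close>.\<close>

lemma minkowski_inverse_unique:
  assumes B: "B \<in> carrier_mat n n"
    and mX: "is_minkowski_inverse n B X" and mY: "is_minkowski_inverse n B Y"
  shows "X = Y"
proof -
  have X: "X \<in> carrier_mat n n" "B * X * B = B" "X * B * X = X"
      "minkowski_adjoint (B * X) = B * X" "minkowski_adjoint (X * B) = X * B"
    and Y: "Y \<in> carrier_mat n n" "B * Y * B = B" "Y * B * Y = Y"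
      "minkowski_adjoint (B * Y) = B * Y" "minkowski_adjoint (Y * B) = Y * B"
    using mX mY unfolding is_minkowski_inverse_def by auto
  have 1: "B * X * (B * Y) = B * Y" "B * Y * (B * X) = B * X"
    using assoc[of "B * X" B Y] assoc[of "B * Y" B X] B X Y by simp_all
  have BX: "B * X = B * Y"
    using minkowski_self_adjoint_commute[of "B * X" "B * Y"] 1 B X Y by simp
  have 2: "X * B * (Y * B) = X * B" "Y * B * (X * B) = Y * B"
    using assoc[of X B "Y * B"] assoc[of Y B "X * B"] assoc[of B Y B] assoc[of B X B] B X Y
    by simp_all
  have XB: "X * B = Y * B"
    using minkowski_self_adjoint_commute[of "X * B" "Y * B"] 2 B X Y by simp
  have "X = X * (B * X)" using X B assoc[of X B X] by simp
  also have "\<dots> = X * B * Y" using X(1) Y(1) B BX by (simp add: assoc)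
  finally show ?thesis using XB Y by simp
qed

text \<open>Powers unfold with the new factor on the right; the defining equation of the m-core-EP
  inverse is used with it on the left.\<close>

lemma pow_mat_Suc_left:
  fixes A :: "complex mat"
  assumes A: "A \<in> carrier_mat n n"
  shows "A ^\<^sub>m (k + 1) = A * A ^\<^sub>m k"
proof (induction k)
  case 0
  then show ?case using A by simp
next
  case (Suc k)
  then show ?case using A by (simp add: assoc)
qed

text \<open>By the range condition \<open>Y = ?K * S\<close>, and \<open>X * A\<close> fixes
  \<open>?K\<close>, so \<open>X * A * Y = Y\<close>; symmetrically with \<open>X\<close> and
  \<open>Y\<close> exchanged. Hence \<open>A * X = A * Y\<close>, and \<open>X = X * A * X\<close>
  equals \<open>Y\<close>.\<close>

lemma m_core_EP_inverse_unique:
  assumes A: "A \<in> carrier_mat n n"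
    and cX: "is_m_core_EP_inverse n A X" and cY: "is_m_core_EP_inverse n A Y"
  shows "X = Y"
proof -
  let ?K = "A ^\<^sub>m mat_index A"
  have K: "?K \<in> carrier_mat n n" using A by simp
  have X: "X \<in> carrier_mat n n" "X * A * X = X" "X * (A * ?K) = ?K"
      "minkowski_adjoint (A * X) = A * X" "vec_space.col_space n X \<subseteq> vec_space.col_space n ?K"
    and Y: "Y \<in> carrier_mat n n" "Y * A * Y = Y" "Y * (A * ?K) = ?K"
      "minkowski_adjoint (A * Y) = A * Y" "vec_space.col_space n Y \<subseteq> vec_space.col_space n ?K"
    using cX cY K A pow_mat_Suc_left[OF A, of "mat_index A"]
    unfolding is_m_core_EP_inverse_def by auto
  obtain R where R: "R \<in> carrier_mat n n" "X = ?K * R"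
    using vec_space.col_space_subset_imp_factor[OF X(1) K X(5)] .
  obtain S where S: "S \<in> carrier_mat n n" "Y = ?K * S"
    using vec_space.col_space_subset_imp_factor[OF Y(1) K Y(5)] .
  have XAY: "X * (A * Y) = Y"
  proof -
    have "X * (A * Y) = X * (A * ?K) * S" using S A X(1) K by (simp add: assoc)
    then show ?thesis using S X by simp
  qed
  have YAX: "Y * (A * X) = X"
  proof -
    have "Y * (A * X) = Y * (A * ?K) * R" using R A Y(1) K by (simp add: assoc)
    then show ?thesis using R Y by simp
  qed
  have "A * X * (A * Y) = A * Y" "A * Y * (A * X) = A * X"
    using XAY YAX A X(1) Y(1) by (simp_all add: assoc)
  then have "A * X = A * Y"
    using minkowski_self_adjoint_commute[of "A * X" "A * Y"] A X Y by simp
  then have "X * (A * X) = Y" using XAY by simp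
  then show ?thesis using X A by (simp add: assoc)
qed

section \<open>The core part \<open>B\<close> and the remaining summand \<open>N\<close> of
  \<open>A\<close>\<close>

context
  fixes A B N Y :: "complex mat"
  assumes A: "A \<in> carrier_mat n n" and B: "B \<in> carrier_mat n n" and N: "N \<in> carrier_mat n n"
    and Y: "Y \<in> carrier_mat n n"
    and AB: "A = B + N" and NB: "N * B = 0\<^sub>m n n" and BBY: "B * B * Y = B"
begin

lemma core_part_mult: "A * B = B * B"
  using AB NB B N add_mult_distrib_mat[of B n n N B n] by simp

text \<open>Since \<open>N * B = 0\<close>, every surviving word of the expanded power that contains
  \<open>B\<close> starts with \<open>B\<close>. Once the power of \<open>N\<close> vanishes,
  \<open>A ^\<^sub>m m\<close> factors through \<open>B\<close>.\<close>

lemma pow_eq_nilpotent_pow_plus_core_mult: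
  "\<exists>P\<in>carrier_mat n n. A ^\<^sub>m m = N ^\<^sub>m m + B * P"
proof (induction m)
  case 0
  then show ?case using A B N by (intro bexI[of _ "0\<^sub>m n n"]) auto
next
  case (Suc m)
  then obtain P where P: "P \<in> carrier_mat n n" "A ^\<^sub>m m = N ^\<^sub>m m + B * P" by auto
  have Nm: "N ^\<^sub>m m \<in> carrier_mat n n" using N by simp
  \<comment> \<open>For \<open>m = 0\<close> the witness is the identity; otherwise the last
    \<open>N\<close> meets \<open>B\<close> and the product is zero.\<close>
  have "\<exists>W\<in>carrier_mat n n. N ^\<^sub>m m * B = B * W"
  proof (cases m)
    case 0
    then show ?thesis using B N by (intro bexI[of _ "1\<^sub>m n"]) auto
  next
    case (Suc l)
    then show ?thesis using B N NB by (intro bexI[of _ "0\<^sub>m n n"]) (auto simp: assoc)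
  qed
  then obtain W where W: "W \<in> carrier_mat n n" "N ^\<^sub>m m * B = B * W" by auto
  have "A ^\<^sub>m Suc m = N ^\<^sub>m m * A + B * P * A"
    using P Nm B A by (simp add: add_mult_distrib_mat[of _ n n])
  also have "N ^\<^sub>m m * A = B * W + N ^\<^sub>m m * N"
    unfolding AB using mult_add_distrib_mat[of "N ^\<^sub>m m" n n B n N] Nm B N W(2) by simp
  also have "B * W + N ^\<^sub>m m * N + B * P * A = N ^\<^sub>m m * N + (B * W + B * P * A)"
    using B W N Nm P A
    by (simp add: assoc_add_mat[of _ n n] comm_add_mat[of "B * W" n n "N ^\<^sub>m m * N"])
  also have "B * W + B * P * A = B * (W + P * A)"
    using B W P A by (simp add: assoc mult_add_distrib_mat[of _ n n])
  finally show ?case using W P A by (intro bexI[of _ "W + P * A"]) auto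
qed

lemma core_part_eq_pow_mult:
  "\<exists>Q\<in>carrier_mat n n. B = A ^\<^sub>m m * Q"
proof -
  \<comment> \<open>The induction keeps a factor \<open>B\<close> before \<open>Q\<close>, so that
    \<open>B = A * B * Y\<close> can be inserted at each step.\<close>
  have "\<exists>Q\<in>carrier_mat n n. B = A ^\<^sub>m m * (B * Q)"
  proof (induction m)
    case 0
    then show ?case using A B by (intro bexI[of _ "1\<^sub>m n"]) auto
  next
    case (Suc m)
    then obtain Q where Q: "Q \<in> carrier_mat n n" "B = A ^\<^sub>m m * (B * Q)" by auto
    have Am: "A ^\<^sub>m m \<in> carrier_mat n n" using A by simp
    have "A ^\<^sub>m Suc m * (B * (Y * Q)) = A ^\<^sub>m m * (A * B * Y * Q)"
      using A Am B Y Q(1) by (simp add: assoc)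
    also have "\<dots> = B" unfolding core_part_mult BBY using Q(2) by (rule sym)
    finally show ?case using Y Q(1) by (intro bexI[of _ "Y * Q"]) auto
  qed
  then show ?thesis using B by (metis closed)
qed

text \<open>Everything rests on \<open>A * ?X = B * M\<close>, which is self-adjoint; the range
  condition follows from \<open>?X = B * (G * M)\<close> and \<open>B = ?K * Q\<close>.\<close>

lemma is_m_core_EP_inverse_core_part:
  assumes nil: "N ^\<^sub>m mat_index A = 0\<^sub>m n n"
    and g: "is_group_inverse n B G" and mi: "is_minkowski_inverse n B M"
  shows "is_m_core_EP_inverse n A (G * B * M)"
proof -
  let ?K = "A ^\<^sub>m mat_index A" and ?X = "G * B * M"
  have K: "?K \<in> carrier_mat n n" using A by simp
  have G: "G \<in> carrier_mat n n" "B * G * B = B" "B * G = G * B"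
    and M: "M \<in> carrier_mat n n" "B * M * B = B" "M * B * M = M"
      "minkowski_adjoint (B * M) = B * M"
    using g mi unfolding is_group_inverse_def is_minkowski_inverse_def by auto
  obtain P where P: "P \<in> carrier_mat n n" "?K = B * P"
    using pow_eq_nilpotent_pow_plus_core_mult[of "mat_index A"] nil B by auto
  obtain Q where Q: "Q \<in> carrier_mat n n" "B = ?K * Q"
    using core_part_eq_pow_mult by blast
  have BBG: "B * (B * G) = B"
    unfolding G(3) using G(1,2) B by (simp add: assoc)
  have GBB: "G * (B * B) = B"
    using G(2) assoc[of G B B] G(1) B unfolding G(3) by simp
  have X: "?X \<in> carrier_mat n n" using G M B by simp
  \<comment> \<open>\<open>G\<close> commutes with \<open>B\<close>, which brings \<open>B\<close>
    to the front of \<open>?X\<close>, and \<open>A\<close> acts on \<open>B\<close> as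
    \<open>B\<close> does.\<close>
  have AX: "A * ?X = B * M"
  proof -
    have "A * ?X = A * (B * G * M)" using G(3) by simp
    also have "\<dots> = A * B * (G * M)" using A B G(1) M(1) by (simp add: assoc)
    also have "\<dots> = B * (B * G) * M"
      unfolding core_part_mult using B G(1) M(1) by (simp add: assoc)
    finally show ?thesis using BBG by simp
  qed
  have "?X * A * ?X = ?X * (B * M)" using X A AX by (simp add: assoc)
  also have "\<dots> = G * (B * M * B) * M" using B G(1) M(1) by (simp add: assoc)
  finally have XAX: "?X * A * ?X = ?X" using M by simp
  have "?X * (A * ?K) = ?X * (A * B * P)" using P A B by (simp add: assoc)
  also have "\<dots> = G * (B * M * B) * B * P"
    unfolding core_part_mult using P(1) B G(1) M(1) by (simp add: assoc)
  also have "\<dots> = G * (B * B) * P" using M(2) P(1) B G(1) by (simp add: assoc)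
  finally have XAK: "?X * A ^\<^sub>m (mat_index A + 1) = ?K"
    unfolding pow_mat_Suc_left[OF A] using GBB P by simp
  have "?X = B * (G * M)"
    unfolding G(3)[symmetric] using B G(1) M(1) by (simp add: assoc)
  then have "?X = ?K * Q * (G * M)" by (simp flip: Q(2))
  then have XK: "?X = ?K * (Q * (G * M))" using K Q(1) G(1) M(1) by (simp add: assoc)
  have "vec_space.col_space n ?X \<subseteq> vec_space.col_space n ?K"
    unfolding XK
    by (rule vec_space.col_space_mult_subset[OF K closed[OF Q(1) closed[OF G(1) M(1)]]])
  then show ?thesis
    unfolding is_m_core_EP_inverse_def carrier_matD(1)[OF X] carrier_matD(1)[OF K]
    using X XAX XAK AX M(4) by simp
qed

end

end

section \<open>From the rank hypotheses to the three inverses\<close>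

theorem theorem2p8:
  fixes A A1 A2 :: "complex mat" and n k r :: nat
  assumes "A \<in> carrier_mat n n"
    and "mat_index A = k"
    and "is_core_EP_decomposition n A A1 A2"
    and "cmat_rank (A ^\<^sub>m k) = r"
    and "cmat_rank (minkowski_adjoint (A ^\<^sub>m k) * A ^\<^sub>m k) = r"
    and "cmat_rank (A1 * minkowski_adjoint A1) = r"
  shows "(\<exists>!X. is_group_inverse n A1 X) \<and>
         (\<exists>!X. is_minkowski_inverse n A1 X) \<and>
         (\<exists>!X. is_m_core_EP_inverse n A X) \<and>
         m_core_EP_inverse A = group_inverse A1 * A1 * minkowski_inverse A1"
proof -
  note A = assms(1)
  let ?a = minkowski_adjoint
  note assoc = assoc_mult_mat[of _ n n _ n _ n]
  have A1: "A1 \<in> carrier_mat n n" and A2: "A2 \<in> carrier_mat n n" and sum: "A = A1 + A2"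
    and rk1: "cmat_rank (A1 ^\<^sub>m 2) = cmat_rank A1"
    and nil: "A2 ^\<^sub>m mat_index A = 0\<^sub>m n n" and A21: "A2 * A1 = 0\<^sub>m n n"
    using assms(3) unfolding is_core_EP_decomposition_def by auto
  have a1 [simp]: "?a A1 \<in> carrier_mat n n" using A1 by simp
  have rkB: "vec_space.rank n (A1 * A1) = vec_space.rank n A1"
    using rk1 A1 by (simp add: numeral_2_eq_2)
  obtain Y where Y: "Y \<in> carrier_mat n n" "A1 = A1 * A1 * Y"
    using rank_mult_right_eq_imp_factor[OF A1 A1 rkB] .
  obtain Z where Z: "Z \<in> carrier_mat n n" "A1 = Z * A1 * A1"
    using rank_mult_left_eq_imp_factor[OF A1 A1 rkB] .
  have group: "\<exists>!X. is_group_inverse n A1 X"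
    using group_inverse_ex[OF A1 Y(1) Z(1)] Y(2) Z(2) group_inverse_unique[OF A1] by metis

  let ?K = "A ^\<^sub>m k"
  have K: "?K \<in> carrier_mat n n" and aK [simp]: "?a ?K \<in> carrier_mat n n" using A by simp_all
  have "A2 ^\<^sub>m k = 0\<^sub>m n n" using nil assms(2) by simp
  then obtain P where P: "P \<in> carrier_mat n n" "?K = A1 * P"
    using pow_eq_nilpotent_pow_plus_core_mult[OF A A1 A2 Y(1) sum A21 Y(2)[symmetric], of k]
      A1 by auto
  obtain Q where Q: "Q \<in> carrier_mat n n" "A1 = ?K * Q"
    using core_part_eq_pow_mult[OF A A1 A2 Y(1) sum A21 Y(2)[symmetric], of k] by blast
  \<comment> \<open>Equal column spaces give \<open>A1\<close> rank \<open>r\<close>, so the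
    hypothesis on \<open>A1 * ?a A1\<close> compares it with \<open>A1\<close> itself.\<close>
  have "vec_space.col_space n A1 \<subseteq> vec_space.col_space n ?K"
    using vec_space.col_space_mult_subset[OF K Q(1)] Q(2) by simp
  moreover have "vec_space.col_space n ?K \<subseteq> vec_space.col_space n A1"
    using vec_space.col_space_mult_subset[OF A1 P(1)] P(2) by simp
  ultimately have rA1: "vec_space.rank n A1 = vec_space.rank n ?K"
    using vec_space.rank_mono_col_space[OF A1 K] vec_space.rank_mono_col_space[OF K A1]
    by (simp add: le_antisym)

  have "vec_space.rank n (?a ?K * ?K) = vec_space.rank n ?K"
    using assms(4,5) A carrier_matD(1)[OF K] carrier_matD(1)[OF aK] by simp
  then obtain W where W: "W \<in> carrier_mat n n" "?K = W * ?a ?K * ?K"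
    using rank_mult_left_eq_imp_factor[OF aK K] by blast
  \<comment> \<open>The factorization of \<open>?K\<close> is carried to \<open>A1\<close>: multiply
    by \<open>Q\<close> on the right and expand \<open>?a ?K\<close> through
    \<open>?K = A1 * P\<close>. This makes \<open>W * ?a P\<close> the left factor for the Minkowski
    inverse.\<close>
  have "A1 = W * ?a ?K * ?K * Q" using Q(2) unfolding W(2)[symmetric] .
  also have "\<dots> = W * ?a ?K * A1" using W(1) K A1 Q(1) Q(2)[symmetric] by (simp add: assoc)
  also have "?a ?K = ?a P * ?a A1"
    unfolding P(2) by (rule minkowski_adjoint_mult[OF A1 P(1)])
  finally have V: "W * ?a P * ?a A1 * A1 = A1"
    using W(1) P(1) A1 by (simp add: assoc)
  have "vec_space.rank n (A1 * ?a A1) = vec_space.rank n A1"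
    using assms(4,6) rA1 A1 carrier_matD(1)[OF K] by simp
  then obtain U where U: "U \<in> carrier_mat n n" "A1 = A1 * ?a A1 * U"
    using rank_mult_right_eq_imp_factor[OF A1 a1] by blast
  have WP: "W * ?a P \<in> carrier_mat n n" using W P by simp
  have mink: "\<exists>!X. is_minkowski_inverse n A1 X"
    using minkowski_inverse_ex[OF A1 WP U(1) V U(2)[symmetric]] minkowski_inverse_unique[OF A1]
    by metis

  \<comment> \<open>Unique existence makes the definite descriptions satisfy their defining
    equations.\<close>
  have G: "is_group_inverse n A1 (group_inverse A1)"
    using theI'[OF group] A1 unfolding group_inverse_def by simp
  have M: "is_minkowski_inverse n A1 (minkowski_inverse A1)"
    using theI'[OF mink] A1 unfolding minkowski_inverse_def by simp
  let ?X = "group_inverse A1 * A1 * minkowski_inverse A1"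
  have X: "is_m_core_EP_inverse n A ?X"
    using is_m_core_EP_inverse_core_part[OF A A1 A2 Y(1) sum A21 Y(2)[symmetric] nil G M] .
  then have core: "\<exists>!X. is_m_core_EP_inverse n A X"
    using m_core_EP_inverse_unique[OF A] by blast
  have "m_core_EP_inverse A = ?X"
    unfolding m_core_EP_inverse_def using the1_equality[OF core X] A by simp
  then show ?thesis using group mink core by blast
qed

end
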